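(* The cocomparison functor $H':\mathbf{DRB}\to\mathbf{RBA}_{\mathbf C'}$ is an isomorphism of categories, i.e., $\mathbf{DRB}$ is comonadic over $\mathbf{RBA}$.
   Context: Fix a commutative ring $\mathbf k$ with identity and $\lambda\in\mathbf k$. All algebras are commutative $\mathbf k$-algebras with identity and algebra homomorphisms preserve the identity. $\mathbb N=\{0,1,2,\dots\}$. A Rota-Baxter operator (of weight $\lambda$) on an algebra $R$ is a $\mathbf k$-linear $P:R\to R$ with $P(x)P(y)=P(xP(y))+P(yP(x))+\lambda P(xy)$ for all $x,y$; $(R,P)$ is then a Rota-Baxter algebra. $\mathbf{RBA}$ is the category of Rota-Baxter algebras, with morphisms $(R,P)\to(S,Q)$ the algebra homomorphisms $f$ with $f\circ P=Q\circ f$. A $\lambda$-derivation on $R$ is a $\mathbf k$-linear $d:R\to R$ with $d(xy)=d(x)y+xd(y)+\lambda d(x)d(y)$ and $d(\mathbf 1_R)=0$. A differential Rota-Baxter algebra (of weight $\lambda$) is a triple $(R,d,P)$ with $d$ a $\lambda$-derivation on $R$, $P$ a Rota-Baxter operator on $R$, and $d\circ P=\mathrm{id}_R$; morphisms are algebra homomorphisms commuting with both operators. $\mathbf{DRB}$ is the resulting category, and $V':\mathbf{DRB}\to\mathbf{RBA}$, $V'(R,d,P)=(R,P)$, is the forgetful functor. $A^{\mathbb N}$ is the algebra of all functions $\mathbb N\to A$ with the product $(fg)(n)=\sum_{k=0}^n\sum_{j=0}^{n-k}\binom nk\binom{n-k}j\lambda^kf(n-j)g(k+j)$; $\partial_A(f)(n)=f(n+1)$;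 for $h:A\to B$, $h^{\mathbb N}(f)(n)=h(f(n))$. For a Rota-Baxter operator $P$ on $A$, $\widetilde P(f)(0)=P(f(0))$, $\widetilde P(f)(n)=f(n-1)$ for $n\ge1$; then $(A^{\mathbb N},\partial_A,\widetilde P)$ is a differential Rota-Baxter algebra. The functor $G':\mathbf{RBA}\to\mathbf{DRB}$, $G'(A,P)=(A^{\mathbb N},\partial_A,\widetilde P)$, $G'(\varphi)=\varphi^{\mathbb N}$, is right adjoint to $V'$, with unit $(\eta'_{(R,d,P)}(x))(n)=d^{(n)}(x)$ and counit $\varepsilon'_{(A,P)}(f)=f(0)$. This adjunction gives the comonad $\mathbf C'=\langle C',\varepsilon',\delta'\rangle$ on $\mathbf{RBA}$: $C'(A,P)=(A^{\mathbb N},\widetilde P)$, $\delta'=V'\eta'G'$, i.e. $(\delta'_{(A,P)}(f)(m))(n)=f(m+n)$. $\mathbf{RBA}_{\mathbf C'}$ is the category of $\mathbf C'$-coalgebras: pairs $\langle(A,P),f\rangle$ with $f:(A,P)\to(A^{\mathbb N},\widetilde P)$ a morphism in $\mathbf{RBA}$ such that $\varepsilon'_{(A,P)}\circ f=\mathrm{id}$ and $\delta'_{(A,P)}\circ f=f^{\mathbb N}\circ f$; morphisms $\langle(A,P),f\rangle\to\langle(B,Q),g\rangle$ are algebra homomorphisms $\varphi:A\to B$ with $g\circ\varphi=\varphi^{\mathbb N}\circ f$ and $Q\circ\varphi=\varphi\circ P$. The cocomparison functor is $H'(R,d,P)=\langle(R,P),\tilde d\rangle$, where $\tilde d=V'(\eta'_{(R,d,P)}):R\to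 R^{\mathbb N}$, $(\tilde d(a))(n)=d^{(n)}(a)$; it is the identity on underlying algebra homomorphisms. *)

theory Defs
  imports "HOL-Algebra.Module" "HOL-Library.FuncSet"
begin

section \<open>Categories, functors, isomorphisms of categories\<close>

text \<open>Categories are given by a set of objects and a family of hom-sets, so composition and
  the action of a functor on morphisms are indexed by the objects involved.\<close>

record ('o, 'm) category =
  Obj :: "'o set"
  Hom :: "'o \<Rightarrow> 'o \<Rightarrow> 'm set"
  Id :: "'o \<Rightarrow> 'm"
  Comp :: "'o \<Rightarrow> 'o \<Rightarrow> 'o \<Rightarrow> 'm \<Rightarrow> 'm \<Rightarrow> 'm"
    \<comment> \<open>\<open>Comp C X Y Z g f\<close> is \<open>g \<circ> f\<close> for \<open>f : X \<rightarrow> Y\<close> and \<open>g : Y \<rightarrow> Z\<close>\<close>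

locale category =
  fixes C :: "('o, 'm) category"
  assumes Id_in_Hom: "X \<in> Obj C \<Longrightarrow> Id C X \<in> Hom C X X"
    and Comp_in_Hom:
      "\<lbrakk>X \<in> Obj C; Y \<in> Obj C; Z \<in> Obj C; f \<in> Hom C X Y; g \<in> Hom C Y Z\<rbrakk>
        \<Longrightarrow> Comp C X Y Z g f \<in> Hom C X Z"
    and Comp_Id_left:
      "\<lbrakk>X \<in> Obj C; Y \<in> Obj C; f \<in> Hom C X Y\<rbrakk> \<Longrightarrow> Comp C X Y Y (Id C Y) f = f"
    and Comp_Id_right:
      "\<lbrakk>X \<in> Obj C; Y \<in> Obj C; f \<in> Hom C X Y\<rbrakk> \<Longrightarrow> Comp C X X Y f (Id C X) = f"
    and Comp_assoc:
      "\<lbrakk>W \<in> Obj C; X \<in> Obj C; Y \<in> Obj C; Z \<in> Obj C;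
        f \<in> Hom C W X; g \<in> Hom C X Y; h \<in> Hom C Y Z\<rbrakk>
        \<Longrightarrow> Comp C W Y Z h (Comp C W X Y g f) = Comp C W X Z (Comp C X Y Z h g) f"

locale cat_functor = dom: category C + cod: category D
  for C :: "('o, 'm) category" and D :: "('p, 'n) category" +
  fixes Fo :: "'o \<Rightarrow> 'p" and Fm :: "'o \<Rightarrow> 'o \<Rightarrow> 'm \<Rightarrow> 'n"
  assumes Fo_in_Obj: "X \<in> Obj C \<Longrightarrow> Fo X \<in> Obj D"
    and Fm_in_Hom:
      "\<lbrakk>X \<in> Obj C; Y \<in> Obj C; f \<in> Hom C X Y\<rbrakk> \<Longrightarrow> Fm X Y f \<in> Hom D (Fo X) (Fo Y)"
    and Fm_Id: "X \<in> Obj C \<Longrightarrow> Fm X X (Id C X) = Id D (Fo X)"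
    and Fm_Comp:
      "\<lbrakk>X \<in> Obj C; Y \<in> Obj C; Z \<in> Obj C; f \<in> Hom C X Y; g \<in> Hom C Y Z\<rbrakk>
        \<Longrightarrow> Fm X Z (Comp C X Y Z g f) = Comp D (Fo X) (Fo Y) (Fo Z) (Fm Y Z g) (Fm X Y f)"

definition category_isomorphism ::
  "('o, 'm) category \<Rightarrow> ('p, 'n) category \<Rightarrow> ('o \<Rightarrow> 'p) \<Rightarrow> ('o \<Rightarrow> 'o \<Rightarrow> 'm \<Rightarrow> 'n) \<Rightarrow> bool" where
  "category_isomorphism C D Fo Fm \<longleftrightarrow>
     cat_functor C D Fo Fm \<and>
     (\<exists>Go Gm. cat_functor D C Go Gm \<and>
        (\<forall>X \<in> Obj C. Go (Fo X) = X) \<and>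
        (\<forall>X \<in> Obj C. \<forall>Y \<in> Obj C. \<forall>f \<in> Hom C X Y. Gm (Fo X) (Fo Y) (Fm X Y f) = f) \<and>
        (\<forall>Y \<in> Obj D. Fo (Go Y) = Y) \<and>
        (\<forall>X \<in> Obj D. \<forall>Y \<in> Obj D. \<forall>g \<in> Hom D X Y. Fm (Go X) (Go Y) (Gm X Y g) = g))"


section \<open>Algebras\<close>

text \<open>The operations of a record are total functions on the ambient type. To make equality of
  records coincide with equality of algebras, all operations (and likewise all operators and
  homomorphisms below) of an object are required to be \<open>undefined\<close> off its carrier.\<close>

definition alg_restrict :: "('k, 'r) ring_scheme \<Rightarrow> ('k, 'a) module \<Rightarrow> ('k, 'a) module" where
  "alg_restrict K A =
     \<lparr>carrier = carrier A,
      mult = (\<lambda>x y. if x \<in> carrier A \<and> y \<in> carrier A then x \<otimes>\<^bsub>A\<^esub> y else undefined),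
      one = \<one>\<^bsub>A\<^esub>,
      zero = \<zero>\<^bsub>A\<^esub>,
      add = (\<lambda>x y. if x \<in> carrier A \<and> y \<in> carrier A then x \<oplus>\<^bsub>A\<^esub> y else undefined),
      smult = (\<lambda>c x. if c \<in> carrier K \<and> x \<in> carrier A then c \<odot>\<^bsub>A\<^esub> x else undefined)\<rparr>"

text \<open>The library locale \<open>algebra\<close> is that of commutative algebras with identity.\<close>

definition is_alg :: "('k, 'r) ring_scheme \<Rightarrow> ('k, 'a) module \<Rightarrow> bool" where
  "is_alg K A \<longleftrightarrow> algebra K A \<and> alg_restrict K A = A"

definition alg_hom ::
  "('k, 'r) ring_scheme \<Rightarrow> ('k, 'a) module \<Rightarrow> ('k, 'b) module \<Rightarrow> ('a \<Rightarrow> 'b) set" where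
  "alg_hom K A B =
     {h \<in> ring_hom A B. h \<in> extensional (carrier A) \<and>
        (\<forall>c \<in> carrier K. \<forall>x \<in> carrier A. h (c \<odot>\<^bsub>A\<^esub> x) = c \<odot>\<^bsub>B\<^esub> h x)}"

definition linear_operator ::
  "('k, 'r) ring_scheme \<Rightarrow> ('k, 'a) module \<Rightarrow> ('a \<Rightarrow> 'a) \<Rightarrow> bool" where
  "linear_operator K A T \<longleftrightarrow>
     T \<in> carrier A \<rightarrow>\<^sub>E carrier A \<and>
     (\<forall>x \<in> carrier A. \<forall>y \<in> carrier A. T (x \<oplus>\<^bsub>A\<^esub> y) = T x \<oplus>\<^bsub>A\<^esub> T y) \<and>
     (\<forall>c \<in> carrier K. \<forall>x \<in> carrier A. T (c \<odot>\<^bsub>A\<^esub> x) = c \<odot>\<^bsub>A\<^esub> T x)"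


section \<open>Rota-Baxter and differential Rota-Baxter algebras\<close>

type_synonym ('k, 'a) rba = "('k, 'a) module \<times> ('a \<Rightarrow> 'a)"  \<comment> \<open>\<open>(R, P)\<close>\<close>
type_synonym ('k, 'a) drb = "('k, 'a) module \<times> ('a \<Rightarrow> 'a) \<times> ('a \<Rightarrow> 'a)"  \<comment> \<open>\<open>(R, d, P)\<close>\<close>

definition rota_baxter_operator ::
  "('k, 'r) ring_scheme \<Rightarrow> 'k \<Rightarrow> ('k, 'a) module \<Rightarrow> ('a \<Rightarrow> 'a) \<Rightarrow> bool" where
  "rota_baxter_operator K l R P \<longleftrightarrow>
     linear_operator K R P \<and>
     (\<forall>x \<in> carrier R. \<forall>y \<in> carrier R.
        P x \<otimes>\<^bsub>R\<^esub> P y = P (x \<otimes>\<^bsub>R\<^esub> P y) \<oplus>\<^bsub>R\<^esub> P (y \<otimes>\<^bsub>R\<^esub> P x) \<oplus>\<^bsub>R\<^esub> l \<odot>\<^bsub>R\<^esub> P (x \<otimes>\<^bsub>R\<^esub> y))"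

definition weighted_derivation ::
  "('k, 'r) ring_scheme \<Rightarrow> 'k \<Rightarrow> ('k, 'a) module \<Rightarrow> ('a \<Rightarrow> 'a) \<Rightarrow> bool" where
  "weighted_derivation K l R d \<longleftrightarrow>
     linear_operator K R d \<and>
     (\<forall>x \<in> carrier R. \<forall>y \<in> carrier R.
        d (x \<otimes>\<^bsub>R\<^esub> y) = d x \<otimes>\<^bsub>R\<^esub> y \<oplus>\<^bsub>R\<^esub> x \<otimes>\<^bsub>R\<^esub> d y \<oplus>\<^bsub>R\<^esub> l \<odot>\<^bsub>R\<^esub> (d x \<otimes>\<^bsub>R\<^esub> d y)) \<and>
     d \<one>\<^bsub>R\<^esub> = \<zero>\<^bsub>R\<^esub>"

definition rba_obj :: "('k, 'r) ring_scheme \<Rightarrow> 'k \<Rightarrow> ('k, 'a) rba \<Rightarrow> bool" where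
  "rba_obj K l = (\<lambda>(R, P). is_alg K R \<and> rota_baxter_operator K l R P)"

definition drb_obj :: "('k, 'r) ring_scheme \<Rightarrow> 'k \<Rightarrow> ('k, 'a) drb \<Rightarrow> bool" where
  "drb_obj K l = (\<lambda>(R, d, P). is_alg K R \<and> weighted_derivation K l R d \<and>
     rota_baxter_operator K l R P \<and> (\<forall>x \<in> carrier R. d (P x) = x))"

text \<open>Source and target may live on different types, since the comonad passes from \<open>'a\<close> to
  \<open>nat \<Rightarrow> 'a\<close>. A morphism is only recognised between actual objects.\<close>

definition rba_mor ::
  "('k, 'r) ring_scheme \<Rightarrow> 'k \<Rightarrow> ('k, 'a) rba \<Rightarrow> ('k, 'b) rba \<Rightarrow> ('a \<Rightarrow> 'b) set" where
  "rba_mor K l = (\<lambda>(R, P) (S, Q).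
     {h \<in> alg_hom K R S. rba_obj K l (R, P) \<and> rba_obj K l (S, Q) \<and>
        (\<forall>x \<in> carrier R. h (P x) = Q (h x))})"

definition drb_mor ::
  "('k, 'r) ring_scheme \<Rightarrow> 'k \<Rightarrow> ('k, 'a) drb \<Rightarrow> ('k, 'b) drb \<Rightarrow> ('a \<Rightarrow> 'b) set" where
  "drb_mor K l = (\<lambda>(R, d, P) (S, e, Q).
     {h \<in> alg_hom K R S. drb_obj K l (R, d, P) \<and> drb_obj K l (S, e, Q) \<and>
        (\<forall>x \<in> carrier R. h (d x) = e (h x)) \<and>
        (\<forall>x \<in> carrier R. h (P x) = Q (h x))})"

definition DRB :: "('k, 'r) ring_scheme \<Rightarrow> 'k \<Rightarrow> (('k, 'a) drb, 'a \<Rightarrow> 'a) category" where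
  "DRB K l =
     \<lparr>Obj = Collect (drb_obj K l),
      Hom = drb_mor K l,
      Id = (\<lambda>(R, d, P). \<lambda>x \<in> carrier R. x),
      Comp = (\<lambda>(R, d, P) Y Z g f. compose (carrier R) g f)\<rparr>"


section \<open>The algebra of sequences and the adjunction between the two kinds of algebras\<close>

definition seq_alg :: "('k, 'r) ring_scheme \<Rightarrow> 'k \<Rightarrow> ('k, 'a) module \<Rightarrow> ('k, nat \<Rightarrow> 'a) module" where
  "seq_alg K l A = alg_restrict K
     \<lparr>carrier = {f. \<forall>n. f n \<in> carrier A},
      mult = (\<lambda>f g n. \<Oplus>\<^bsub>A\<^esub> k \<in> {0..n}. \<Oplus>\<^bsub>A\<^esub> j \<in> {0..n - k}.
                add_pow A ((n choose k) * ((n - k) choose j))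
                  ((l [^]\<^bsub>K\<^esub> k) \<odot>\<^bsub>A\<^esub> (f (n - j) \<otimes>\<^bsub>A\<^esub> g (k + j)))),
      one = (\<lambda>n. if n = 0 then \<one>\<^bsub>A\<^esub> else \<zero>\<^bsub>A\<^esub>),
      zero = (\<lambda>n. \<zero>\<^bsub>A\<^esub>),
      add = (\<lambda>f g n. f n \<oplus>\<^bsub>A\<^esub> g n),
      smult = (\<lambda>c f n. c \<odot>\<^bsub>A\<^esub> f n)\<rparr>"

definition seq_shift ::
  "('k, 'r) ring_scheme \<Rightarrow> 'k \<Rightarrow> ('k, 'a) module \<Rightarrow> (nat \<Rightarrow> 'a) \<Rightarrow> (nat \<Rightarrow> 'a)" where
  "seq_shift K l A = (\<lambda>f \<in> carrier (seq_alg K l A). \<lambda>n. f (Suc n))"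

definition seq_map ::
  "('k, 'r) ring_scheme \<Rightarrow> 'k \<Rightarrow> ('k, 'a) module \<Rightarrow> ('a \<Rightarrow> 'b) \<Rightarrow> (nat \<Rightarrow> 'a) \<Rightarrow> (nat \<Rightarrow> 'b)" where
  "seq_map K l A h = (\<lambda>f \<in> carrier (seq_alg K l A). \<lambda>n. h (f n))"

definition seq_rb ::
  "('k, 'r) ring_scheme \<Rightarrow> 'k \<Rightarrow> ('k, 'a) module \<Rightarrow> ('a \<Rightarrow> 'a) \<Rightarrow> (nat \<Rightarrow> 'a) \<Rightarrow> (nat \<Rightarrow> 'a)" where
  "seq_rb K l A P =
     (\<lambda>f \<in> carrier (seq_alg K l A). \<lambda>n. if n = 0 then P (f 0) else f (n - 1))"

definition V_obj :: "('k, 'a) drb \<Rightarrow> ('k, 'a) rba" where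
  "V_obj = (\<lambda>(R, d, P). (R, P))"

definition G_obj ::
  "('k, 'r) ring_scheme \<Rightarrow> 'k \<Rightarrow> ('k, 'a) rba \<Rightarrow> ('k, nat \<Rightarrow> 'a) drb" where
  "G_obj K l = (\<lambda>(A, P). (seq_alg K l A, seq_shift K l A, seq_rb K l A P))"

definition adj_unit :: "('k, 'a) drb \<Rightarrow> 'a \<Rightarrow> (nat \<Rightarrow> 'a)" where
  "adj_unit = (\<lambda>(R, d, P). \<lambda>x \<in> carrier R. \<lambda>n. (d ^^ n) x)"

definition adj_counit ::
  "('k, 'r) ring_scheme \<Rightarrow> 'k \<Rightarrow> ('k, 'a) rba \<Rightarrow> (nat \<Rightarrow> 'a) \<Rightarrow> 'a" where
  "adj_counit K l = (\<lambda>(A, P). \<lambda>f \<in> carrier (seq_alg K l A). f 0)"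


section \<open>The comonad and its coalgebras\<close>

text \<open>The comonad is \<open>V \<circ> G\<close>, with counit \<open>adj_counit\<close> and comultiplication \<open>V \<eta> G\<close>; on
  morphisms \<open>V\<close> is the identity and \<open>G\<close> is \<open>seq_map\<close>.\<close>

definition comonad_obj ::
  "('k, 'r) ring_scheme \<Rightarrow> 'k \<Rightarrow> ('k, 'a) rba \<Rightarrow> ('k, nat \<Rightarrow> 'a) rba" where
  "comonad_obj K l X = V_obj (G_obj K l X)"

definition comult ::
  "('k, 'r) ring_scheme \<Rightarrow> 'k \<Rightarrow> ('k, 'a) rba \<Rightarrow> (nat \<Rightarrow> 'a) \<Rightarrow> (nat \<Rightarrow> nat \<Rightarrow> 'a)" where
  "comult K l X = adj_unit (G_obj K l X)"

lemma comult_apply: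
  assumes "f \<in> carrier (seq_alg K l A)"
  shows "comult K l (A, P) f m n = f (m + n)"
proof -
  have "(seq_shift K l A ^^ m) f = (\<lambda>n. f (m + n))"
  proof (induction m)
    case (Suc m)
    have "(\<lambda>n. f (m + n)) \<in> carrier (seq_alg K l A)"
      using assms by (simp add: seq_alg_def alg_restrict_def)
    with Suc show ?case by (simp add: seq_shift_def)
  qed simp
  with assms show ?thesis by (simp add: comult_def adj_unit_def G_obj_def)
qed

type_synonym ('k, 'a) coalg = "('k, 'a) rba \<times> ('a \<Rightarrow> nat \<Rightarrow> 'a)"

definition coalg_obj :: "('k, 'r) ring_scheme \<Rightarrow> 'k \<Rightarrow> ('k, 'a) coalg \<Rightarrow> bool" where
  "coalg_obj K l = (\<lambda>((A, P), f).
     rba_obj K l (A, P) \<and>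
     f \<in> rba_mor K l (A, P) (comonad_obj K l (A, P)) \<and>
     compose (carrier A) (adj_counit K l (A, P)) f = (\<lambda>x \<in> carrier A. x) \<and>
     compose (carrier A) (comult K l (A, P)) f = compose (carrier A) (seq_map K l A f) f)"

definition coalg_mor ::
  "('k, 'r) ring_scheme \<Rightarrow> 'k \<Rightarrow> ('k, 'a) coalg \<Rightarrow> ('k, 'a) coalg \<Rightarrow> ('a \<Rightarrow> 'a) set" where
  "coalg_mor K l = (\<lambda>((A, P), f) ((B, Q), g).
     {h \<in> rba_mor K l (A, P) (B, Q). coalg_obj K l ((A, P), f) \<and> coalg_obj K l ((B, Q), g) \<and>
        compose (carrier A) g h = compose (carrier A) (seq_map K l A h) f})"

definition RBA_coalg :: "('k, 'r) ring_scheme \<Rightarrow> 'k \<Rightarrow> (('k, 'a) coalg, 'a \<Rightarrow> 'a) category" where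
  "RBA_coalg K l =
     \<lparr>Obj = Collect (coalg_obj K l),
      Hom = coalg_mor K l,
      Id = (\<lambda>((A, P), f). \<lambda>x \<in> carrier A. x),
      Comp = (\<lambda>((A, P), f) Y Z g h. compose (carrier A) g h)\<rparr>"


section \<open>The cocomparison functor\<close>

definition cocomparison_obj :: "('k, 'a) drb \<Rightarrow> ('k, 'a) coalg" where
  "cocomparison_obj X = (V_obj X, adj_unit X)"

definition cocomparison_mor ::
  "('k, 'a) drb \<Rightarrow> ('k, 'a) drb \<Rightarrow> ('a \<Rightarrow> 'a) \<Rightarrow> ('a \<Rightarrow> 'a)" where
  "cocomparison_mor X Y h = h"

end

theory Submission
  imports Defs
begin

text \<open>
  A coalgebra structure on a Rota-Baxter algebra is a sequence-valued map \<open>f\<close>, and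
  coassociativity, read as \<open>f x (m + n) = f (f x m) n\<close>, says that the entries of \<open>f x\<close> are the
  iterates of the single operator \<open>d x = f x 1\<close>. So the data of a coalgebra are the data of one
  operator, and it remains to see that the conditions match: the Rota-Baxter morphisms
  \<open>R \<rightarrow> R\<^sup>\<nat>\<close> of the form \<open>x \<mapsto> (d\<^sup>n x)\<^sub>n\<close> are precisely those for which \<open>d\<close> is a weighted derivation
  with \<open>d \<circ> P = id\<close>. In one direction the entry with index 1 of the morphism laws gives the laws
  for \<open>d\<close> (\<open>coalg_obj_iterates\<close>); in the other, the laws for \<open>d\<close> propagate to all iterates
  (\<open>coalg_obj_cocomparison\<close>). On morphisms the situation is the same: commuting with \<open>d\<close> is
  commuting with all its iterates (\<open>coalg_mor_cocomparison\<close>). Hence the cocomparison functor is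
  bijective on objects and does not change hom-sets, identities or composition, and such a
  correspondence is an isomorphism of categories (\<open>category_isomorphism_transport\<close>).

  That all this takes place among Rota-Baxter algebras requires that \<open>R\<^sup>\<nat>\<close> is one. The double sum
  that defines its product is opaque, but it is determined by two rules: the entry at 0 of
  \<open>f g\<close> is \<open>f 0 g 0\<close>, and deleting the first entry is a weighted derivation (\<open>seq_mult_0\<close>,
  \<open>seq_mult_Suc\<close>). The second rule amounts to the Pascal recursion for the trinomial expansion
  of \<open>(D \<otimes> 1 + 1 \<otimes> D + \<lambda> D \<otimes> D)\<^sup>n\<close>, with \<open>D\<close> the deletion of the first entry. Once it is
  available, every identity between sequences (commutativity, associativity, the Rota-Baxter
  equation, the higher Leibniz rule) follows by comparing first entries and tails.
\<close>

section \<open>Binomial sums in abelian monoids\<close>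

definition (in abelian_monoid) binom_sum :: "nat \<Rightarrow> (nat \<Rightarrow> 'a) \<Rightarrow> 'a" where
  "binom_sum n u = (\<Oplus>k\<in>{0..n}. add_pow G (n choose k) (u k))"

context abelian_monoid
begin

lemma binom_sum_closed:
  assumes "\<And>k. u k \<in> carrier G"
  shows "binom_sum n u \<in> carrier G"
  using assms by (auto simp: binom_sum_def intro!: finsum_closed)

lemma binom_sum_cong:
  assumes "\<And>k. v k \<in> carrier G" "\<And>k. k \<le> n \<Longrightarrow> u k = v k"
  shows "binom_sum n u = binom_sum n v"
  unfolding binom_sum_def by (rule finsum_cong') (use assms in auto)

lemma binom_sum_add:
  assumes "\<And>k. u k \<in> carrier G" "\<And>k. v k \<in> carrier G"
  shows "binom_sum n (\<lambda>k. u k \<oplus> v k) = binom_sum n u \<oplus> binom_sum n v"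
  using assms by (simp add: binom_sum_def add.nat_pow_distrib finsum_addf Pi_def)

text \<open>The Pascal rule splits each coefficient of \<open>u (Suc i)\<close> in two; the lone term \<open>u 0\<close> completes
  one of the halves to a full sum.\<close>

lemma binom_sum_Suc:
  assumes u: "\<And>k. u k \<in> carrier G"
  shows "binom_sum (Suc n) u = binom_sum n u \<oplus> binom_sum n (\<lambda>k. u (Suc k))"
proof -
  let ?w = "\<lambda>i. add_pow G (n choose i) (u i)"
  let ?x = "\<Oplus>i\<in>{..n}. add_pow G (n choose i) (u (Suc i))"
  let ?y = "\<Oplus>i\<in>{..n}. ?w (Suc i)"
  have cl: "?x \<in> carrier G" "?y \<in> carrier G"
    by (auto intro!: finsum_closed simp: u)
  have "binom_sum (Suc n) u
      = (\<Oplus>i\<in>{..n}. add_pow G (n choose i) (u (Suc i)) \<oplus> ?w (Suc i)) \<oplus> u 0"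
    unfolding binom_sum_def atLeast0AtMost
    by (subst finsum_Suc2) (auto simp: u add.nat_pow_mult)
  also have "\<dots> = ?x \<oplus> (?y \<oplus> u 0)"
    by (subst finsum_addf) (use cl u in \<open>auto simp: a_assoc\<close>)
  also have "?y \<oplus> u 0 = (\<Oplus>i\<in>{..Suc n}. ?w i)"
    by (subst finsum_Suc2) (auto simp: u)
  also have "\<dots> = (\<Oplus>i\<in>{..n}. ?w i)"
    by (subst finsum_Suc) (auto simp: u binomial_eq_0)
  finally show ?thesis
    using cl u by (simp add: binom_sum_def atLeast0AtMost a_comm finsum_closed Pi_def)
qed

lemma additive_map_add_pow:
  assumes add: "\<And>x y. \<lbrakk>x \<in> carrier G; y \<in> carrier G\<rbrakk> \<Longrightarrow> \<phi> (x \<oplus> y) = \<phi> x \<oplus> \<phi> y"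
    and zero: "\<phi> \<zero> = \<zero>" and x: "x \<in> carrier G"
  shows "\<phi> (add_pow G (m::nat) x) = add_pow G m (\<phi> x)"
  by (induction m) (use x in \<open>simp_all add: zero add\<close>)

lemma additive_map_binom_sum:
  assumes add: "\<And>x y. \<lbrakk>x \<in> carrier G; y \<in> carrier G\<rbrakk> \<Longrightarrow> \<phi> (x \<oplus> y) = \<phi> x \<oplus> \<phi> y"
    and zero: "\<phi> \<zero> = \<zero>" and closed: "\<And>x. x \<in> carrier G \<Longrightarrow> \<phi> x \<in> carrier G"
    and u: "\<And>k. u k \<in> carrier G"
  shows "\<phi> (binom_sum n u) = binom_sum n (\<lambda>k. \<phi> (u k))"
proof -
  have "\<phi> (\<Oplus>k\<in>F. add_pow G (n choose k) (u k)) = (\<Oplus>k\<in>F. add_pow G (n choose k) (\<phi> (u k)))"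
    if "finite F" for F
    using that
  proof induction
    case (insert k F)
    then show ?case
      by (simp add: u closed add finsum_closed Pi_def additive_map_add_pow[OF add zero])
  qed (simp add: zero)
  then show ?thesis by (simp add: binom_sum_def)
qed

end

section \<open>The product of sequences as a recursion\<close>

text \<open>This is the map underlying \<^const>\<open>seq_shift\<close>, free of the carrier bookkeeping.\<close>

definition tail :: "(nat \<Rightarrow> 'a) \<Rightarrow> nat \<Rightarrow> 'a" where
  "tail f n = f (Suc n)"

text \<open>This is the map underlying \<^const>\<open>adj_unit\<close>, free of the carrier bookkeeping.\<close>

definition iterates :: "('a \<Rightarrow> 'a) \<Rightarrow> 'a \<Rightarrow> nat \<Rightarrow> 'a" where
  "iterates d x n = (d ^^ n) x"

locale weighted_algebra = algebra K A
  for K :: "('k, 'r) ring_scheme" (structure) and A :: "('k, 'a) module" (structure) +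
  fixes l :: 'k
  assumes l_closed [simp]: "l \<in> carrier K"
begin

abbreviation S where "S \<equiv> seq_alg K l A"

lemma seq_carrier: "carrier S = {f. \<forall>n. f n \<in> carrier A}"
  by (simp add: seq_alg_def alg_restrict_def)

lemma seq_zero: "\<zero>\<^bsub>S\<^esub> = (\<lambda>n. \<zero>\<^bsub>A\<^esub>)"
  and seq_one: "\<one>\<^bsub>S\<^esub> = (\<lambda>n. if n = 0 then \<one>\<^bsub>A\<^esub> else \<zero>\<^bsub>A\<^esub>)"
  by (simp_all add: seq_alg_def alg_restrict_def)

lemma seq_zero_apply: "\<zero>\<^bsub>S\<^esub> n = \<zero>\<^bsub>A\<^esub>"
  by (simp add: seq_zero)

lemma seq_add:
  "\<lbrakk>f \<in> carrier S; g \<in> carrier S\<rbrakk> \<Longrightarrow> (f \<oplus>\<^bsub>S\<^esub> g) n = f n \<oplus>\<^bsub>A\<^esub> g n"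
  by (simp add: seq_alg_def alg_restrict_def)

lemma seq_smult:
  "\<lbrakk>c \<in> carrier K; f \<in> carrier S\<rbrakk> \<Longrightarrow> (c \<odot>\<^bsub>S\<^esub> f) n = c \<odot>\<^bsub>A\<^esub> f n"
  by (simp add: seq_alg_def alg_restrict_def)

lemma seq_mult_expand:
  assumes "f \<in> carrier S" "g \<in> carrier S"
  shows "(f \<otimes>\<^bsub>S\<^esub> g) n = (\<Oplus>\<^bsub>A\<^esub>k\<in>{0..n}. \<Oplus>\<^bsub>A\<^esub>j\<in>{0..n - k}.
      add_pow A ((n choose k) * ((n - k) choose j))
        ((l [^]\<^bsub>K\<^esub> k) \<odot>\<^bsub>A\<^esub> (f (n - j) \<otimes>\<^bsub>A\<^esub> g (k + j))))"
  using assms by (simp add: seq_alg_def alg_restrict_def)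

lemma seq_memI: "(\<And>n. f n \<in> carrier A) \<Longrightarrow> f \<in> carrier S"
  by (simp add: seq_carrier)

lemma seq_closed [simp]: "f \<in> carrier S \<Longrightarrow> f n \<in> carrier A"
  by (simp add: seq_carrier)

lemma tail_closed [simp]: "f \<in> carrier S \<Longrightarrow> tail f \<in> carrier S"
  by (rule seq_memI) (simp add: tail_def)

text \<open>With \<open>D\<^sub>1 F i j = F (i + 1) j\<close> and \<open>D\<^sub>2 F i j = F i (j + 1)\<close>, the value of \<open>binom_prod m F\<close> is that
  of \<open>(D\<^sub>1 + D\<^sub>2)\<^sup>m F\<close> at the origin, and \<open>weighted_prod n F\<close> is that of
  \<open>((D\<^sub>1 + D\<^sub>2) + l D\<^sub>1 D\<^sub>2)\<^sup>n F\<close>, each expanded by the binomial theorem. Working with an arbitrary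
  double sequence \<open>F\<close> instead of \<open>\<lambda>i j. f i \<otimes> g j\<close> separates this combinatorics from the
  multiplication of the algebra.\<close>

definition binom_prod :: "nat \<Rightarrow> (nat \<Rightarrow> nat \<Rightarrow> 'a) \<Rightarrow> 'a" where
  "binom_prod m F = M.binom_sum m (\<lambda>j. F (m - j) j)"

definition weighted_prod :: "nat \<Rightarrow> (nat \<Rightarrow> nat \<Rightarrow> 'a) \<Rightarrow> 'a" where
  "weighted_prod n F =
     M.binom_sum n (\<lambda>k. (l [^]\<^bsub>K\<^esub> k) \<odot>\<^bsub>A\<^esub> binom_prod (n - k) (\<lambda>i j. F (i + k) (j + k)))"

lemma binom_prod_closed:
  assumes "\<And>i j. F i j \<in> carrier A"
  shows "binom_prod m F \<in> carrier A"
  using assms by (simp add: binom_prod_def M.binom_sum_closed)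

lemma weighted_prod_closed:
  assumes "\<And>i j. F i j \<in> carrier A"
  shows "weighted_prod n F \<in> carrier A"
  using assms by (simp add: weighted_prod_def M.binom_sum_closed binom_prod_closed)

lemma binom_prod_Suc:
  assumes F: "\<And>i j. F i j \<in> carrier A"
  shows "binom_prod (Suc m) F =
    binom_prod m (\<lambda>i j. F (Suc i) j) \<oplus>\<^bsub>A\<^esub> binom_prod m (\<lambda>i j. F i (Suc j))"
proof -
  have "M.binom_sum m (\<lambda>j. F (Suc m - j) j) = M.binom_sum m (\<lambda>j. F (Suc (m - j)) j)"
    by (rule M.binom_sum_cong) (simp_all add: F Suc_diff_le)
  then show ?thesis
    by (simp add: binom_prod_def M.binom_sum_Suc F)
qed

text \<open>The Pascal rule for the outer sum gives two sums: in the first, the exponent of \<open>D\<^sub>1 + D\<^sub>2\<close> is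
  raised by one, in the second, that of \<open>l D\<^sub>1 D\<^sub>2\<close>.\<close>

lemma weighted_prod_Suc:
  assumes F: "\<And>i j. F i j \<in> carrier A"
  shows "weighted_prod (Suc n) F =
    weighted_prod n (\<lambda>i j. F (Suc i) j) \<oplus>\<^bsub>A\<^esub> weighted_prod n (\<lambda>i j. F i (Suc j))
    \<oplus>\<^bsub>A\<^esub> l \<odot>\<^bsub>A\<^esub> weighted_prod n (\<lambda>i j. F (Suc i) (Suc j))"
proof -
  let ?t = "\<lambda>n F k. (l [^]\<^bsub>K\<^esub> k) \<odot>\<^bsub>A\<^esub> binom_prod (n - k) (\<lambda>i j. F (i + k) (j + k))"
  have "M.binom_sum n (?t (Suc n) F)
      = M.binom_sum n (\<lambda>k. ?t n (\<lambda>i j. F (Suc i) j) k \<oplus>\<^bsub>A\<^esub> ?t n (\<lambda>i j. F i (Suc j)) k)"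
    by (rule M.binom_sum_cong)
      (simp_all add: F binom_prod_closed Suc_diff_le binom_prod_Suc smult_r_distr)
  also have "\<dots> = weighted_prod n (\<lambda>i j. F (Suc i) j) \<oplus>\<^bsub>A\<^esub> weighted_prod n (\<lambda>i j. F i (Suc j))"
    unfolding weighted_prod_def by (rule M.binom_sum_add) (simp_all add: binom_prod_closed F)
  finally have first: "M.binom_sum n (?t (Suc n) F) = \<dots>" .
  have "M.binom_sum n (\<lambda>k. ?t (Suc n) F (Suc k))
      = M.binom_sum n (\<lambda>k. l \<odot>\<^bsub>A\<^esub> ?t n (\<lambda>i j. F (Suc i) (Suc j)) k)"
    by (rule M.binom_sum_cong)
      (simp_all add: F binom_prod_closed smult_assoc1[symmetric] R.m_comm[of l])
  also have "\<dots> = l \<odot>\<^bsub>A\<^esub> weighted_prod n (\<lambda>i j. F (Suc i) (Suc j))"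
    unfolding weighted_prod_def
    by (rule M.additive_map_binom_sum[symmetric, where \<phi> = "\<lambda>x. l \<odot>\<^bsub>A\<^esub> x"])
      (simp_all add: smult_r_distr F binom_prod_closed)
  finally have second: "M.binom_sum n (\<lambda>k. ?t (Suc n) F (Suc k)) = \<dots>" .
  have "weighted_prod (Suc n) F =
      M.binom_sum n (?t (Suc n) F) \<oplus>\<^bsub>A\<^esub> M.binom_sum n (\<lambda>k. ?t (Suc n) F (Suc k))"
    unfolding weighted_prod_def by (rule M.binom_sum_Suc) (simp add: binom_prod_closed F)
  then show ?thesis by (simp only: first second)
qed

text \<open>Here the product of two binomial coefficients is read as one binomial sum inside another; the
  factors that depend on the outer index alone move out of the inner sum.\<close>

lemma seq_mult:
  assumes f: "f \<in> carrier S" and g: "g \<in> carrier S"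
  shows "f \<otimes>\<^bsub>S\<^esub> g = (\<lambda>n. weighted_prod n (\<lambda>i j. f i \<otimes>\<^bsub>A\<^esub> g j))"
proof
  fix n
  let ?F = "\<lambda>k i j. f (i + k) \<otimes>\<^bsub>A\<^esub> g (j + k)"
  have F: "?F k i j \<in> carrier A" for k i j using f g by simp
  have inner: "(\<Oplus>\<^bsub>A\<^esub>j\<in>{0..n - k}. add_pow A ((n choose k) * ((n - k) choose j))
           ((l [^]\<^bsub>K\<^esub> k) \<odot>\<^bsub>A\<^esub> (f (n - j) \<otimes>\<^bsub>A\<^esub> g (k + j))))
      = add_pow A (n choose k) ((l [^]\<^bsub>K\<^esub> k) \<odot>\<^bsub>A\<^esub> binom_prod (n - k) (?F k))" (is "?L = ?R")
    if k: "k \<le> n" for k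
  proof -
    let ?p = "\<lambda>x. add_pow A (n choose k) ((l [^]\<^bsub>K\<^esub> k) \<odot>\<^bsub>A\<^esub> x)"
    have "?L = M.binom_sum (n - k) (\<lambda>j. ?p (?F k (n - k - j) j))"
      unfolding M.binom_sum_def
      by (rule M.finsum_cong')
        (use k f g in \<open>auto simp: M.add.nat_pow_pow add.commute mult.commute\<close>)
    also have "\<dots> = ?p (M.binom_sum (n - k) (\<lambda>j. ?F k (n - k - j) j))"
      by (rule M.additive_map_binom_sum[symmetric, where \<phi> = ?p])
        (simp_all add: smult_r_distr M.add.nat_pow_distrib F)
    finally show ?thesis by (simp add: binom_prod_def)
  qed
  have "(f \<otimes>\<^bsub>S\<^esub> g) n = (\<Oplus>\<^bsub>A\<^esub>k\<in>{0..n}. \<Oplus>\<^bsub>A\<^esub>j\<in>{0..n - k}.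
      add_pow A ((n choose k) * ((n - k) choose j))
        ((l [^]\<^bsub>K\<^esub> k) \<odot>\<^bsub>A\<^esub> (f (n - j) \<otimes>\<^bsub>A\<^esub> g (k + j))))"
    by (rule seq_mult_expand[OF f g])
  also have "\<dots> = weighted_prod n (?F 0)"
    unfolding weighted_prod_def M.binom_sum_def
    by (rule M.finsum_cong') (simp_all add: inner F binom_prod_closed)
  finally show "(f \<otimes>\<^bsub>S\<^esub> g) n = weighted_prod n (\<lambda>i j. f i \<otimes>\<^bsub>A\<^esub> g j)" by simp
qed

lemma seq_mult_closed [simp]:
  "\<lbrakk>f \<in> carrier S; g \<in> carrier S\<rbrakk> \<Longrightarrow> f \<otimes>\<^bsub>S\<^esub> g \<in> carrier S"
  by (rule seq_memI) (simp add: seq_mult weighted_prod_closed)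

lemma seq_add_closed [simp]:
  "\<lbrakk>f \<in> carrier S; g \<in> carrier S\<rbrakk> \<Longrightarrow> f \<oplus>\<^bsub>S\<^esub> g \<in> carrier S"
  by (rule seq_memI) (simp add: seq_add)

lemma seq_smult_closed [simp]:
  "\<lbrakk>c \<in> carrier K; f \<in> carrier S\<rbrakk> \<Longrightarrow> c \<odot>\<^bsub>S\<^esub> f \<in> carrier S"
  by (rule seq_memI) (simp add: seq_smult)

lemma seq_zero_closed [simp]: "\<zero>\<^bsub>S\<^esub> \<in> carrier S"
  and seq_one_closed [simp]: "\<one>\<^bsub>S\<^esub> \<in> carrier S"
  by (auto intro!: seq_memI simp: seq_zero seq_one)

lemma tail_zero: "tail \<zero>\<^bsub>S\<^esub> = \<zero>\<^bsub>S\<^esub>" and tail_one: "tail \<one>\<^bsub>S\<^esub> = \<zero>\<^bsub>S\<^esub>"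
  by (auto simp: tail_def seq_zero seq_one)

lemma tail_add:
  "\<lbrakk>f \<in> carrier S; g \<in> carrier S\<rbrakk> \<Longrightarrow> tail (f \<oplus>\<^bsub>S\<^esub> g) = tail f \<oplus>\<^bsub>S\<^esub> tail g"
  by (rule ext) (simp add: seq_add tail_closed[unfolded tail_def] tail_def)

lemma tail_smult:
  "\<lbrakk>c \<in> carrier K; f \<in> carrier S\<rbrakk> \<Longrightarrow> tail (c \<odot>\<^bsub>S\<^esub> f) = c \<odot>\<^bsub>S\<^esub> tail f"
  by (rule ext) (simp add: seq_smult tail_closed[unfolded tail_def] tail_def)

lemma seq_mult_0:
  "\<lbrakk>f \<in> carrier S; g \<in> carrier S\<rbrakk> \<Longrightarrow> (f \<otimes>\<^bsub>S\<^esub> g) 0 = f 0 \<otimes>\<^bsub>A\<^esub> g 0"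
  by (simp add: seq_mult weighted_prod_def binom_prod_def M.binom_sum_def)

lemma seq_mult_Suc:
  "\<lbrakk>f \<in> carrier S; g \<in> carrier S\<rbrakk> \<Longrightarrow> (f \<otimes>\<^bsub>S\<^esub> g) (Suc n) =
     (tail f \<otimes>\<^bsub>S\<^esub> g) n \<oplus>\<^bsub>A\<^esub> (f \<otimes>\<^bsub>S\<^esub> tail g) n \<oplus>\<^bsub>A\<^esub> l \<odot>\<^bsub>A\<^esub> (tail f \<otimes>\<^bsub>S\<^esub> tail g) n"
  by (simp add: seq_mult weighted_prod_Suc) (simp add: tail_def)

lemma tail_mult:
  "\<lbrakk>f \<in> carrier S; g \<in> carrier S\<rbrakk> \<Longrightarrow> tail (f \<otimes>\<^bsub>S\<^esub> g) =
     tail f \<otimes>\<^bsub>S\<^esub> g \<oplus>\<^bsub>S\<^esub> f \<otimes>\<^bsub>S\<^esub> tail g \<oplus>\<^bsub>S\<^esub> l \<odot>\<^bsub>S\<^esub> (tail f \<otimes>\<^bsub>S\<^esub> tail g)"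
  by (rule ext) (simp add: tail_def[of "f \<otimes>\<^bsub>S\<^esub> g"] seq_mult_Suc seq_add seq_smult)

section \<open>The algebra of sequences\<close>

text \<open>The algebra laws are proved entry by entry by induction on the index, for all sequences at
  once: the entry with index \<open>n + 1\<close> of a product is a combination of entries with index \<open>n\<close> of
  products in which some factors are replaced by their tails.\<close>

lemma seq_mult_comm:
  assumes "f \<in> carrier S" "g \<in> carrier S"
  shows "f \<otimes>\<^bsub>S\<^esub> g = g \<otimes>\<^bsub>S\<^esub> f"
proof
  fix n
  show "(f \<otimes>\<^bsub>S\<^esub> g) n = (g \<otimes>\<^bsub>S\<^esub> f) n"
    using assms
  proof (induction n arbitrary: f g)
    case (Suc n)
    have "(tail f \<otimes>\<^bsub>S\<^esub> g) n = (g \<otimes>\<^bsub>S\<^esub> tail f) n" "(f \<otimes>\<^bsub>S\<^esub> tail g) n = (tail g \<otimes>\<^bsub>S\<^esub> f) n"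
      "(tail f \<otimes>\<^bsub>S\<^esub> tail g) n = (tail g \<otimes>\<^bsub>S\<^esub> tail f) n"
      using Suc.prems by (simp_all only: Suc.IH tail_closed)
    with Suc.prems show ?case by (simp add: seq_mult_Suc M.a_comm)
  qed (simp add: seq_mult_0 m_comm)
qed

lemma seq_l_distr:
  assumes "f \<in> carrier S" "g \<in> carrier S" "h \<in> carrier S"
  shows "(f \<oplus>\<^bsub>S\<^esub> g) \<otimes>\<^bsub>S\<^esub> h = f \<otimes>\<^bsub>S\<^esub> h \<oplus>\<^bsub>S\<^esub> g \<otimes>\<^bsub>S\<^esub> h"
proof
  fix n
  have "((f \<oplus>\<^bsub>S\<^esub> g) \<otimes>\<^bsub>S\<^esub> h) n = (f \<otimes>\<^bsub>S\<^esub> h) n \<oplus>\<^bsub>A\<^esub> (g \<otimes>\<^bsub>S\<^esub> h) n"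
    using assms
  proof (induction n arbitrary: f g h)
    case 0
    then show ?case by (simp add: seq_mult_0 seq_add[of _ _ 0] l_distr)
  next
    case (Suc n)
    then show ?case by (simp add: seq_mult_Suc tail_add smult_r_distr M.a_ac)
  qed
  then show "((f \<oplus>\<^bsub>S\<^esub> g) \<otimes>\<^bsub>S\<^esub> h) n = (f \<otimes>\<^bsub>S\<^esub> h \<oplus>\<^bsub>S\<^esub> g \<otimes>\<^bsub>S\<^esub> h) n"
    using assms by (simp add: seq_add[of _ _ n])
qed

lemma seq_smult_assoc2:
  assumes "c \<in> carrier K" "f \<in> carrier S" "g \<in> carrier S"
  shows "(c \<odot>\<^bsub>S\<^esub> f) \<otimes>\<^bsub>S\<^esub> g = c \<odot>\<^bsub>S\<^esub> (f \<otimes>\<^bsub>S\<^esub> g)"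
proof
  fix n
  have "((c \<odot>\<^bsub>S\<^esub> f) \<otimes>\<^bsub>S\<^esub> g) n = c \<odot>\<^bsub>A\<^esub> (f \<otimes>\<^bsub>S\<^esub> g) n"
    using assms(2,3)
  proof (induction n arbitrary: f g)
    case 0
    then show ?case using assms(1) by (simp add: seq_mult_0 seq_smult[of _ _ 0] smult_assoc2)
  next
    case (Suc n)
    then show ?case using assms(1)
      by (simp add: seq_mult_Suc tail_smult smult_r_distr smult_assoc1[symmetric] R.m_comm)
  qed
  then show "((c \<odot>\<^bsub>S\<^esub> f) \<otimes>\<^bsub>S\<^esub> g) n = (c \<odot>\<^bsub>S\<^esub> (f \<otimes>\<^bsub>S\<^esub> g)) n"
    using assms by (simp add: seq_smult[of _ _ n])
qed

text \<open>In the inductive step both sides expand into the same seven terms, one for each nonempty set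
  of factors that are replaced by their tails; the expansion needs that the product is bilinear.\<close>

lemma seq_mult_assoc:
  assumes "f \<in> carrier S" "g \<in> carrier S" "h \<in> carrier S"
  shows "(f \<otimes>\<^bsub>S\<^esub> g) \<otimes>\<^bsub>S\<^esub> h = f \<otimes>\<^bsub>S\<^esub> (g \<otimes>\<^bsub>S\<^esub> h)"
proof
  have r_distr: "f \<otimes>\<^bsub>S\<^esub> (g \<oplus>\<^bsub>S\<^esub> h) = f \<otimes>\<^bsub>S\<^esub> g \<oplus>\<^bsub>S\<^esub> f \<otimes>\<^bsub>S\<^esub> h"
    if "f \<in> carrier S" "g \<in> carrier S" "h \<in> carrier S" for f g h
    using that seq_l_distr[of g h f] by (simp add: seq_mult_comm[of f])
  have smult_r: "f \<otimes>\<^bsub>S\<^esub> (l \<odot>\<^bsub>S\<^esub> g) = l \<odot>\<^bsub>S\<^esub> (f \<otimes>\<^bsub>S\<^esub> g)"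
    if "f \<in> carrier S" "g \<in> carrier S" for f g
    using that seq_smult_assoc2[of l g f] by (simp add: seq_mult_comm[of f])
  fix n
  show "((f \<otimes>\<^bsub>S\<^esub> g) \<otimes>\<^bsub>S\<^esub> h) n = (f \<otimes>\<^bsub>S\<^esub> (g \<otimes>\<^bsub>S\<^esub> h)) n"
    using assms
  proof (induction n arbitrary: f g h)
    case 0
    then show ?case by (simp add: seq_mult_0 m_assoc)
  next
    case (Suc n)
    then show ?case
      by (simp add: seq_mult_Suc tail_mult seq_l_distr r_distr seq_smult_assoc2 smult_r
          seq_add[of _ _ n] seq_smult[of _ _ n] smult_r_distr M.a_ac)
  qed
qed

lemma seq_zero_mult:
  assumes "f \<in> carrier S"
  shows "(\<zero>\<^bsub>S\<^esub> \<otimes>\<^bsub>S\<^esub> f) n = \<zero>\<^bsub>A\<^esub>"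
  using assms
proof (induction n arbitrary: f)
  case 0
  then show ?case by (simp add: seq_mult_0) (simp add: seq_zero)
next
  case (Suc n)
  then show ?case by (simp add: seq_mult_Suc tail_zero)
qed

lemma seq_one_mult:
  assumes "f \<in> carrier S"
  shows "\<one>\<^bsub>S\<^esub> \<otimes>\<^bsub>S\<^esub> f = f"
proof
  fix n
  show "(\<one>\<^bsub>S\<^esub> \<otimes>\<^bsub>S\<^esub> f) n = f n"
    using assms
  proof (induction n arbitrary: f)
    case 0
    then show ?case by (simp add: seq_mult_0) (simp add: seq_one)
  next
    case (Suc n)
    then show ?case by (simp add: seq_mult_Suc tail_one seq_zero_mult) (simp add: tail_def)
  qed
qed

lemma algebra_seq_alg: "algebra K S"
proof (rule algebraI)
  show "cring S"
  proof (rule cringI)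
    show "abelian_group S"
    proof (rule abelian_groupI)
      fix f assume f: "f \<in> carrier S"
      have g: "(\<lambda>n. \<ominus>\<^bsub>A\<^esub> f n) \<in> carrier S" using f by (auto intro: seq_memI)
      show "\<exists>g\<in>carrier S. g \<oplus>\<^bsub>S\<^esub> f = \<zero>\<^bsub>S\<^esub>"
        by (rule bexI[OF _ g], rule ext) (simp add: seq_add f g seq_zero M.l_neg)
      show "\<zero>\<^bsub>S\<^esub> \<oplus>\<^bsub>S\<^esub> f = f"
        by (rule ext) (simp add: seq_add f seq_zero_apply)
    qed (simp_all, (rule ext, simp add: seq_add M.a_ac)+)
    show "comm_monoid S"
      by (rule comm_monoidI) (simp_all add: seq_mult_assoc seq_one_mult, rule seq_mult_comm)
  qed (rule seq_l_distr)
qed (simp_all add: R_cring seq_smult_assoc2,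
    (rule ext, simp add: seq_add seq_smult smult_l_distr smult_r_distr smult_assoc1)+)

lemma is_alg_seq_alg: "is_alg K S"
proof -
  have "alg_restrict K (alg_restrict K B) = alg_restrict K B" for B :: "(_, 'x) module"
    by (simp add: alg_restrict_def fun_eq_iff)
  then show ?thesis
    by (simp add: is_alg_def algebra_seq_alg) (simp add: seq_alg_def)
qed


lemma seq_eqI: "f 0 = g 0 \<Longrightarrow> tail f = tail g \<Longrightarrow> f = g"
proof
  fix n assume "f 0 = g 0" "tail f = tail g"
  then show "f n = g n" by (cases n) (auto simp: tail_def dest: fun_cong)
qed

text \<open>Prepending \<open>P (f 0)\<close> to \<open>f\<close> is inverse to taking the tail. So at the tails the Rota-Baxter
  equation is the product rule for \<^const>\<open>tail\<close>, and only at index 0 is it the Rota-Baxter equation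
  for \<open>P\<close>.\<close>

lemma rota_baxter_seq_rb:
  assumes P: "rota_baxter_operator K l A P"
  shows "rota_baxter_operator K l S (seq_rb K l A P)"
proof -
  let ?Q = "seq_rb K l A P"
  have Pc: "P x \<in> carrier A" if "x \<in> carrier A" for x
    using P that by (auto simp: rota_baxter_operator_def linear_operator_def)
  have Qc [simp]: "?Q f \<in> carrier S" if "f \<in> carrier S" for f
    using that by (intro seq_memI) (simp add: seq_rb_def Pc)
  have Q0: "?Q f 0 = P (f 0)" and tlQ: "tail (?Q f) = f" if "f \<in> carrier S" for f
    using that by (auto simp: seq_rb_def tail_def)
  have "linear_operator K S ?Q"
    unfolding linear_operator_def
  proof (intro conjI ballI)
    show "?Q \<in> carrier S \<rightarrow>\<^sub>E carrier S"
      by (rule PiE_I) (simp, simp add: seq_rb_def)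
  next
    fix f g assume "f \<in> carrier S" "g \<in> carrier S"
    then show "?Q (f \<oplus>\<^bsub>S\<^esub> g) = ?Q f \<oplus>\<^bsub>S\<^esub> ?Q g"
      using P by - (rule seq_eqI,
        simp_all add: Q0 tlQ tail_add seq_add[of _ _ 0] rota_baxter_operator_def linear_operator_def)
  next
    fix c f assume "c \<in> carrier K" "f \<in> carrier S"
    then show "?Q (c \<odot>\<^bsub>S\<^esub> f) = c \<odot>\<^bsub>S\<^esub> ?Q f"
      using P by - (rule seq_eqI,
        simp_all add: Q0 tlQ tail_smult seq_smult[of _ _ 0] rota_baxter_operator_def linear_operator_def)
  qed
  moreover have "?Q f \<otimes>\<^bsub>S\<^esub> ?Q g =
      ?Q (f \<otimes>\<^bsub>S\<^esub> ?Q g) \<oplus>\<^bsub>S\<^esub> ?Q (g \<otimes>\<^bsub>S\<^esub> ?Q f) \<oplus>\<^bsub>S\<^esub> l \<odot>\<^bsub>S\<^esub> ?Q (f \<otimes>\<^bsub>S\<^esub> g)"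
    if "f \<in> carrier S" "g \<in> carrier S" for f g
  proof (rule seq_eqI)
    show "(?Q f \<otimes>\<^bsub>S\<^esub> ?Q g) 0 =
      (?Q (f \<otimes>\<^bsub>S\<^esub> ?Q g) \<oplus>\<^bsub>S\<^esub> ?Q (g \<otimes>\<^bsub>S\<^esub> ?Q f) \<oplus>\<^bsub>S\<^esub> l \<odot>\<^bsub>S\<^esub> ?Q (f \<otimes>\<^bsub>S\<^esub> g)) 0"
      using that P
      by (simp add: seq_mult_0 seq_add[of _ _ 0] seq_smult[of _ _ 0] Q0 rota_baxter_operator_def)
    show "tail (?Q f \<otimes>\<^bsub>S\<^esub> ?Q g) =
      tail (?Q (f \<otimes>\<^bsub>S\<^esub> ?Q g) \<oplus>\<^bsub>S\<^esub> ?Q (g \<otimes>\<^bsub>S\<^esub> ?Q f) \<oplus>\<^bsub>S\<^esub> l \<odot>\<^bsub>S\<^esub> ?Q (f \<otimes>\<^bsub>S\<^esub> g))"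
      using that by (simp add: tail_mult tail_add tail_smult tlQ seq_mult_comm[of "?Q f" g])
  qed
  ultimately show ?thesis by (simp add: rota_baxter_operator_def)
qed

lemma rba_obj_seq:
  assumes "rba_obj K l (A, P)"
  shows "rba_obj K l (comonad_obj K l (A, P))"
  using assms
  by (simp add: rba_obj_def comonad_obj_def V_obj_def G_obj_def is_alg_seq_alg rota_baxter_seq_rb)

lemma tail_iterates: "tail (iterates d x) = iterates d (d x)"
  by (simp add: tail_def iterates_def fun_eq_iff funpow_Suc_right del: funpow.simps)

lemma iterates_closed:
  assumes "d \<in> carrier A \<rightarrow> carrier A" "x \<in> carrier A"
  shows "iterates d x \<in> carrier S"
proof (rule seq_memI)
  show "iterates d x n \<in> carrier A" for n
    using assms by (induction n) (auto simp: iterates_def)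
qed

section \<open>Iterating a weighted derivation\<close>

context
  fixes d
  assumes d: "weighted_derivation K l A d"
begin

lemma derivation_closed: "x \<in> carrier A \<Longrightarrow> d x \<in> carrier A"
  using d by (auto simp: weighted_derivation_def linear_operator_def)

lemma iterates_in_seq: "x \<in> carrier A \<Longrightarrow> iterates d x \<in> carrier S"
  by (rule iterates_closed) (auto simp: derivation_closed)

lemma iterates_add:
  assumes "x \<in> carrier A" "y \<in> carrier A"
  shows "iterates d (x \<oplus>\<^bsub>A\<^esub> y) = iterates d x \<oplus>\<^bsub>S\<^esub> iterates d y"
proof
  fix n
  have "(d ^^ n) (x \<oplus>\<^bsub>A\<^esub> y) = (d ^^ n) x \<oplus>\<^bsub>A\<^esub> (d ^^ n) y"
    using d iterates_in_seq[THEN seq_closed, OF assms(1)] iterates_in_seq[THEN seq_closed, OF assms(2)]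
    by (induction n) (simp_all add: weighted_derivation_def linear_operator_def iterates_def)
  then show "iterates d (x \<oplus>\<^bsub>A\<^esub> y) n = (iterates d x \<oplus>\<^bsub>S\<^esub> iterates d y) n"
    using assms by (simp add: seq_add[of _ _ n] iterates_in_seq) (simp add: iterates_def)
qed

lemma iterates_smult:
  assumes "c \<in> carrier K" "x \<in> carrier A"
  shows "iterates d (c \<odot>\<^bsub>A\<^esub> x) = c \<odot>\<^bsub>S\<^esub> iterates d x"
proof
  fix n
  have "(d ^^ n) (c \<odot>\<^bsub>A\<^esub> x) = c \<odot>\<^bsub>A\<^esub> (d ^^ n) x"
    using d assms(1) iterates_in_seq[THEN seq_closed, OF assms(2)]
    by (induction n) (simp_all add: weighted_derivation_def linear_operator_def iterates_def)
  then show "iterates d (c \<odot>\<^bsub>A\<^esub> x) n = (c \<odot>\<^bsub>S\<^esub> iterates d x) n"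
    using assms by (simp add: seq_smult[of _ _ n] iterates_in_seq) (simp add: iterates_def)
qed

lemma iterates_zero: "iterates d \<zero>\<^bsub>A\<^esub> = \<zero>\<^bsub>S\<^esub>"
  using iterates_smult[OF R.zero_closed M.zero_closed]
  by (simp add: module.smult_l_null[OF algebra.module[OF algebra_seq_alg]] iterates_in_seq)

lemma iterates_one: "iterates d \<one>\<^bsub>A\<^esub> = \<one>\<^bsub>S\<^esub>"
proof (rule seq_eqI)
  show "iterates d \<one>\<^bsub>A\<^esub> 0 = \<one>\<^bsub>S\<^esub> 0" by (simp add: iterates_def seq_one)
  show "tail (iterates d \<one>\<^bsub>A\<^esub>) = tail \<one>\<^bsub>S\<^esub>"
    using d by (simp add: tail_iterates tail_one iterates_zero weighted_derivation_def)
qed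

text \<open>This is the Leibniz rule for higher weighted derivations. Its induction step is the product
  rule for \<open>d\<close> on one side and the recursion for the product of sequences on the other.\<close>

lemma iterates_mult:
  assumes "x \<in> carrier A" "y \<in> carrier A"
  shows "iterates d (x \<otimes>\<^bsub>A\<^esub> y) = iterates d x \<otimes>\<^bsub>S\<^esub> iterates d y"
proof
  fix n
  have Suc_n: "iterates d x (Suc n) = iterates d (d x) n" for x n
    using fun_cong[OF tail_iterates[of d x], of n] by (simp add: tail_def)
  show "iterates d (x \<otimes>\<^bsub>A\<^esub> y) n = (iterates d x \<otimes>\<^bsub>S\<^esub> iterates d y) n"
    using assms
  proof (induction n arbitrary: x y)
    case 0
    then show ?case by (simp add: seq_mult_0 iterates_in_seq) (simp add: iterates_def)
  next
    case (Suc n)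
    have "d (x \<otimes>\<^bsub>A\<^esub> y) = d x \<otimes>\<^bsub>A\<^esub> y \<oplus>\<^bsub>A\<^esub> x \<otimes>\<^bsub>A\<^esub> d y \<oplus>\<^bsub>A\<^esub> l \<odot>\<^bsub>A\<^esub> (d x \<otimes>\<^bsub>A\<^esub> d y)"
      using d Suc.prems by (simp add: weighted_derivation_def)
    with Suc.prems show ?case
      by (simp add: Suc_n seq_mult_Suc iterates_in_seq tail_iterates derivation_closed
          iterates_add iterates_smult seq_add[of _ _ n] seq_smult[of _ _ n] Suc.IH)
  qed
qed

lemma iterates_alg_hom: "restrict (iterates d) (carrier A) \<in> alg_hom K A S"
  unfolding alg_hom_def
  by (auto intro!: ring_hom_memI
      simp: iterates_in_seq iterates_add iterates_mult iterates_one iterates_smult)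

end

end

section \<open>Differential Rota-Baxter algebras as coalgebras\<close>

lemma drb_obj_iff:
  "drb_obj K l (A, d, P) \<longleftrightarrow>
     rba_obj K l (A, P) \<and> weighted_derivation K l A d \<and> (\<forall>x\<in>carrier A. d (P x) = x)"
  by (auto simp: drb_obj_def rba_obj_def)

lemma adj_unit_eq: "adj_unit (A, d, P) = restrict (iterates d) (carrier A)"
  by (simp add: adj_unit_def iterates_def[abs_def])

lemma rba_obj_weighted_algebra:
  assumes "l \<in> carrier K" "rba_obj K l (A, P)"
  shows "weighted_algebra K A l"
  using assms
  by (auto simp: rba_obj_def is_alg_def weighted_algebra_def weighted_algebra_axioms_def)

text \<open>The counit and coassociativity laws say \<open>d\<^sup>0 x = x\<close> and \<open>d\<^sup>m\<^sup>+\<^sup>n x = d\<^sup>n (d\<^sup>m x)\<close>. That the iterates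
  commute with the Rota-Baxter operators is where \<open>d \<circ> P = id\<close> enters.\<close>

lemma coalg_obj_cocomparison:
  assumes l: "l \<in> carrier K" and X: "drb_obj K l X"
  shows "coalg_obj K l (cocomparison_obj X)"
proof -
  obtain A d P where X_eq: "X = (A, d, P)" by (cases X)
  have rba: "rba_obj K l (A, P)" and d: "weighted_derivation K l A d"
    and dP: "\<And>x. x \<in> carrier A \<Longrightarrow> d (P x) = x"
    using X by (auto simp: X_eq drb_obj_iff)
  interpret weighted_algebra K A l by (rule rba_obj_weighted_algebra[OF l rba])
  have Pc: "P x \<in> carrier A" if "x \<in> carrier A" for x
    using rba that by (auto simp: rba_obj_def rota_baxter_operator_def linear_operator_def)
  have "iterates d (P x) = seq_rb K l A P (iterates d x)" if x: "x \<in> carrier A" for x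
  proof (rule seq_eqI)
    show "iterates d (P x) 0 = seq_rb K l A P (iterates d x) 0"
      using d x by (simp add: seq_rb_def iterates_in_seq) (simp add: iterates_def)
    show "tail (iterates d (P x)) = tail (seq_rb K l A P (iterates d x))"
      by (rule ext) (simp add: tail_iterates dP x tail_def[of "seq_rb K l A P _"],
          simp add: seq_rb_def iterates_in_seq d x)
  qed
  then have "adj_unit X \<in> rba_mor K l (A, P) (comonad_obj K l (A, P))"
    using rba rba_obj_seq[OF rba] iterates_alg_hom[OF d]
    by (simp add: rba_mor_def comonad_obj_def V_obj_def G_obj_def X_eq adj_unit_eq Pc)
  moreover have "compose (carrier A) (adj_counit K l (A, P)) (adj_unit X) = (\<lambda>x\<in>carrier A. x)"
    by (rule ext) (simp add: compose_def adj_counit_def X_eq adj_unit_eq iterates_in_seq[OF d],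
      simp add: iterates_def)
  moreover have "compose (carrier A) (comult K l (A, P)) (adj_unit X)
      = compose (carrier A) (seq_map K l A (adj_unit X)) (adj_unit X)"
  proof (rule ext)
    fix x
    show "compose (carrier A) (comult K l (A, P)) (adj_unit X) x
      = compose (carrier A) (seq_map K l A (adj_unit X)) (adj_unit X) x"
    proof (cases "x \<in> carrier A")
      case True
      have "comult K l (A, P) (iterates d x) m n = iterates d (iterates d x m) n" for m n
        unfolding comult_apply[OF iterates_in_seq[OF d True]]
        by (simp add: iterates_def add.commute[of m n] funpow_add)
      with True show ?thesis
        by (simp add: compose_def X_eq adj_unit_eq seq_map_def iterates_in_seq[OF d] fun_eq_iff)
    qed (simp add: compose_def)
  qed
  ultimately show ?thesis
    using rba by (simp add: coalg_obj_def cocomparison_obj_def X_eq V_obj_def)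
qed

text \<open>The structure map of a coalgebra consists of iterates by coassociativity with second index 1.
  Each law for \<open>d\<close> is the entry with index 1 of a law for \<open>f\<close>; for products this entry involves,
  besides the values of \<open>d\<close>, the entries with index 0, which the counit law identifies.\<close>

lemma coalg_obj_iterates:
  assumes l: "l \<in> carrier K" and C: "coalg_obj K l ((A, P), f)"
  defines "d \<equiv> (\<lambda>x\<in>carrier A. f x 1)"
  shows "drb_obj K l (A, d, P)" and "cocomparison_obj (A, d, P) = ((A, P), f)"
proof -
  have rba: "rba_obj K l (A, P)" using C by (simp add: coalg_obj_def)
  interpret weighted_algebra K A l by (rule rba_obj_weighted_algebra[OF l rba])
  have hom: "f \<in> ring_hom A S" and ext: "f \<in> extensional (carrier A)"
    and fsmult: "\<And>c x. c \<in> carrier K \<Longrightarrow> x \<in> carrier A \<Longrightarrow> f (c \<odot>\<^bsub>A\<^esub> x) = c \<odot>\<^bsub>S\<^esub> f x"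
    and fP: "\<And>x. x \<in> carrier A \<Longrightarrow> f (P x) = seq_rb K l A P (f x)"
    using C
    by (auto simp: coalg_obj_def rba_mor_def alg_hom_def comonad_obj_def V_obj_def G_obj_def)
  have fc [simp]: "x \<in> carrier A \<Longrightarrow> f x \<in> carrier S" for x
    using ring_hom_closed[OF hom] .
  have Pc [simp]: "P x \<in> carrier A" if "x \<in> carrier A" for x
    using rba that by (auto simp: rba_obj_def rota_baxter_operator_def linear_operator_def)
  have f0: "f x 0 = x" if "x \<in> carrier A" for x
  proof -
    have "compose (carrier A) (adj_counit K l (A, P)) f x = (\<lambda>x\<in>carrier A. x) x"
      using C by (simp add: coalg_obj_def)
    with that show ?thesis by (simp add: compose_def adj_counit_def)
  qed
  have coassoc: "f x (m + n) = f (f x m) n" if "x \<in> carrier A" for x m n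
  proof -
    have "compose (carrier A) (comult K l (A, P)) f x = compose (carrier A) (seq_map K l A f) f x"
      using C by (simp add: coalg_obj_def)
    then have "comult K l (A, P) (f x) m n = f (f x m) n"
      using that by (simp add: compose_def seq_map_def)
    with that show ?thesis by (simp add: comult_apply)
  qed
  have f_iter: "f x n = iterates d x n" if "x \<in> carrier A" for x n
  proof (induction n)
    case (Suc n)
    have "f x (Suc n) = d (f x n)" using coassoc[OF that, of n 1] that by (simp add: d_def)
    with Suc show ?case by (simp add: iterates_def)
  qed (simp add: iterates_def f0 that)
  have "linear_operator K A d"
    unfolding linear_operator_def
    by (auto simp: d_def fsmult ring_hom_add[OF hom] seq_add[of _ _ "Suc 0"] seq_smult[of _ _ "Suc 0"])
  moreover have "d (x \<otimes>\<^bsub>A\<^esub> y) = d x \<otimes>\<^bsub>A\<^esub> y \<oplus>\<^bsub>A\<^esub> x \<otimes>\<^bsub>A\<^esub> d y \<oplus>\<^bsub>A\<^esub> l \<odot>\<^bsub>A\<^esub> (d x \<otimes>\<^bsub>A\<^esub> d y)"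
    if "x \<in> carrier A" "y \<in> carrier A" for x y
    using that seq_mult_Suc[of "f x" "f y" 0]
    by (simp add: d_def ring_hom_mult[OF hom] seq_mult_0 tail_def f0)
  moreover have "d \<one>\<^bsub>A\<^esub> = \<zero>\<^bsub>A\<^esub>"
    by (simp add: d_def ring_hom_one[OF hom] seq_one)
  moreover have "d (P x) = x" if "x \<in> carrier A" for x
    using that by (simp add: d_def fP) (simp add: seq_rb_def f0)
  ultimately show "drb_obj K l (A, d, P)"
    using rba by (simp add: drb_obj_iff weighted_derivation_def)
  have "restrict (iterates d) (carrier A) = f"
    using ext by (auto simp: fun_eq_iff f_iter restrict_def extensional_def)
  then show "cocomparison_obj (A, d, P) = ((A, P), f)"
    by (simp add: cocomparison_obj_def V_obj_def adj_unit_eq)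
qed

lemma cocomparison_obj_bij:
  fixes K :: "('k, 'r) ring_scheme"
  assumes l: "l \<in> carrier K"
  shows "bij_betw cocomparison_obj (Collect (drb_obj K l :: ('k, 'a) drb \<Rightarrow> bool)) (Collect (coalg_obj K l))"
proof (rule bij_betwI')
  fix X Y :: "('k, 'a) drb"
  assume "X \<in> Collect (drb_obj K l)" "Y \<in> Collect (drb_obj K l)"
  moreover obtain A d P B e Q where XY: "X = (A, d, P)" "Y = (B, e, Q)"
    by (cases X, cases Y)
  ultimately have ext: "d \<in> extensional (carrier A)" "e \<in> extensional (carrier B)"
    by (auto simp: drb_obj_def weighted_derivation_def linear_operator_def PiE_def)
  have "d = e" if "A = B" "adj_unit (A, d, P) = adj_unit (A, e, Q)"
  proof (rule extensionalityI[of _ "carrier A"])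
    fix x assume "x \<in> carrier A"
    with fun_cong[OF fun_cong[OF that(2)], of x 1] show "d x = e x"
      by (simp add: adj_unit_def)
  qed (use ext that(1) in simp_all)
  then show "(cocomparison_obj X = cocomparison_obj Y) = (X = Y)"
    by (auto simp: XY cocomparison_obj_def V_obj_def)
next
  fix X :: "('k, 'a) drb" assume "X \<in> Collect (drb_obj K l)"
  then show "cocomparison_obj X \<in> Collect (coalg_obj K l)"
    using coalg_obj_cocomparison[OF l] by simp
next
  fix Y :: "('k, 'a) coalg" assume "Y \<in> Collect (coalg_obj K l)"
  moreover obtain A P f where "Y = ((A, P), f)" by (metis prod.exhaust)
  ultimately show "\<exists>X\<in>Collect (drb_obj K l). Y = cocomparison_obj X"
    using coalg_obj_iterates[OF l, of A P f]
    by (intro bexI[of _ "(A, \<lambda>x\<in>carrier A. f x 1, P)"]) auto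
qed

lemma coalg_mor_cocomparison:
  assumes l: "l \<in> carrier K" and X: "drb_obj K l X" and Y: "drb_obj K l Y"
  shows "coalg_mor K l (cocomparison_obj X) (cocomparison_obj Y) = drb_mor K l X Y"
proof -
  obtain A d P B e Q where XY: "X = (A, d, P)" "Y = (B, e, Q)" by (cases X, cases Y)
  have rba: "rba_obj K l (A, P)" and d: "weighted_derivation K l A d"
    and rbaY: "rba_obj K l (B, Q)"
    using X Y by (auto simp: XY drb_obj_iff)
  interpret weighted_algebra K A l by (rule rba_obj_weighted_algebra[OF l rba])
  have "compose (carrier A) (adj_unit Y) h = compose (carrier A) (seq_map K l A h) (adj_unit X)
      \<longleftrightarrow> (\<forall>x\<in>carrier A. h (d x) = e (h x))" (is "?L \<longleftrightarrow> ?R")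
    if h: "h \<in> carrier A \<rightarrow> carrier B" for h
  proof -
    have "?L \<longleftrightarrow> (\<forall>x\<in>carrier A. \<forall>n. (e ^^ n) (h x) = h ((d ^^ n) x))"
      using h iterates_in_seq[OF d]
      by (auto simp: fun_eq_iff compose_def seq_map_def XY adj_unit_eq iterates_def Pi_iff)
    also have "\<dots> \<longleftrightarrow> ?R"
    proof
      assume *: "\<forall>x\<in>carrier A. \<forall>n. (e ^^ n) (h x) = h ((d ^^ n) x)"
      show ?R using *[rule_format, of _ 1] by simp
    next
      assume R: ?R
      have "(e ^^ n) (h x) = h ((d ^^ n) x)" if "x \<in> carrier A" for x n
        using R seq_closed[OF iterates_in_seq[OF d that]]
        by (induction n) (simp_all add: iterates_def)
      then show "\<forall>x\<in>carrier A. \<forall>n. (e ^^ n) (h x) = h ((d ^^ n) x)" by simp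
    qed
    finally show ?thesis .
  qed
  moreover have "h \<in> carrier A \<rightarrow> carrier B" if "h \<in> alg_hom K A B" for h
    using that by (auto simp: alg_hom_def dest: ring_hom_closed)
  ultimately show ?thesis
    using X Y rba rbaY coalg_obj_cocomparison[OF l X] coalg_obj_cocomparison[OF l Y]
    by (auto simp: coalg_mor_def drb_mor_def rba_mor_def XY cocomparison_obj_def V_obj_def)
qed

section \<open>The isomorphism of categories\<close>

lemma alg_hom_compose:
  assumes "f \<in> alg_hom K A B" "g \<in> alg_hom K B C" "algebra K A"
  shows "compose (carrier A) g f \<in> alg_hom K A C"
proof -
  interpret algebra K A by fact
  show ?thesis
    using assms
    by (auto simp: alg_hom_def ring_hom_def compose_def Pi_iff)
qed

lemma category_DRB: "category (DRB K l :: (('k, 'a) drb, 'a \<Rightarrow> 'a) category)"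
proof -
  have ext: "f \<in> extensional (carrier A)" and map: "f \<in> carrier A \<rightarrow> carrier B"
    if "f \<in> drb_mor K l (A, d, P) (B, e, Q)" for f A d P B e Q
    using that by (auto simp: drb_mor_def alg_hom_def dest: ring_hom_closed)
  show ?thesis
  proof
    fix X :: "('k, 'a) drb"
    assume "X \<in> Obj (DRB K l)"
    moreover obtain A d P where X: "X = (A, d, P)" by (cases X)
    ultimately have obj: "drb_obj K l (A, d, P)" by (simp add: DRB_def)
    interpret algebra K A using obj by (simp add: drb_obj_def is_alg_def)
    show "Id (DRB K l) X \<in> Hom (DRB K l) X X"
      using obj unfolding drb_obj_def
      by (auto simp: DRB_def X drb_mor_def alg_hom_def ring_hom_def rota_baxter_operator_def
          weighted_derivation_def linear_operator_def drb_obj_def)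
  next
    fix X Y Z :: "('k, 'a) drb" and f g
    assume fg: "f \<in> Hom (DRB K l) X Y" "g \<in> Hom (DRB K l) Y Z" and X: "X \<in> Obj (DRB K l)"
    obtain A d P B e Q C c T where XYZ: "X = (A, d, P)" "Y = (B, e, Q)" "Z = (C, c, T)"
      by (cases X, cases Y, cases Z)
    have alg: "algebra K A" using X by (simp add: DRB_def XYZ drb_obj_def is_alg_def)
    have cl: "d x \<in> carrier A" "P x \<in> carrier A" "f x \<in> carrier B" if "x \<in> carrier A" for x
      using X that fg(1) map[of f A d P B e Q]
      by (auto simp: DRB_def XYZ drb_obj_def weighted_derivation_def rota_baxter_operator_def
          linear_operator_def)
    show "Comp (DRB K l) X Y Z g f \<in> Hom (DRB K l) X Z"
      using fg alg_hom_compose[OF _ _ alg, of f B g C] cl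
      by (simp add: DRB_def XYZ drb_mor_def) (simp add: compose_def)
  next
    fix X Y :: "('k, 'a) drb" and f
    assume f: "f \<in> Hom (DRB K l) X Y"
    obtain A d P B e Q where XY: "X = (A, d, P)" "Y = (B, e, Q)" by (cases X, cases Y)
    note f' = f[unfolded XY DRB_def, simplified]
    show "Comp (DRB K l) X Y Y (Id (DRB K l) Y) f = f"
      using Id_compose[OF map[OF f'] ext[OF f']] by (simp add: DRB_def XY)
    show "Comp (DRB K l) X X Y f (Id (DRB K l) X) = f"
      using compose_Id[OF map[OF f'] ext[OF f']] by (simp add: DRB_def XY)
  next
    fix W X Y Z :: "('k, 'a) drb" and f g h
    assume "f \<in> Hom (DRB K l) W X"
    moreover obtain A d P B e Q where WX: "W = (A, d, P)" "X = (B, e, Q)" by (cases W, cases X)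
    ultimately have "f \<in> carrier A \<rightarrow> carrier B" using map[of f A d P B e Q] by (simp add: DRB_def)
    then show "Comp (DRB K l) W Y Z h (Comp (DRB K l) W X Y g f) =
        Comp (DRB K l) W X Z (Comp (DRB K l) X Y Z h g) f"
      by (cases Y) (simp add: DRB_def WX compose_assoc)
  qed
qed

text \<open>That \<open>D\<close> is a category is a conclusion here: its laws are those of \<open>C\<close>, transported along the
  bijection on objects.\<close>

lemma category_isomorphism_transport:
  fixes C :: "('o, 'm) category" and D :: "('p, 'm) category"
  assumes C: "category C" and bij: "bij_betw F (Obj C) (Obj D)"
    and hom: "\<And>X Y. \<lbrakk>X \<in> Obj C; Y \<in> Obj C\<rbrakk> \<Longrightarrow> Hom D (F X) (F Y) = Hom C X Y"
    and id: "\<And>X. X \<in> Obj C \<Longrightarrow> Id D (F X) = Id C X"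
    and comp: "\<And>X Y Z. \<lbrakk>X \<in> Obj C; Y \<in> Obj C; Z \<in> Obj C\<rbrakk>
      \<Longrightarrow> Comp D (F X) (F Y) (F Z) = Comp C X Y Z"
  shows "category_isomorphism C D F (\<lambda>X Y h. h)"
proof -
  interpret C: category C by fact
  define G where "G = the_inv_into (Obj C) F"
  have GF: "G (F X) = X" if "X \<in> Obj C" for X
    using that bij by (simp add: G_def bij_betw_def the_inv_into_f_f)
  have FG: "F (G Y) = Y" and G: "G Y \<in> Obj C" if "Y \<in> Obj D" for Y
    using that bij bij_betw_apply[OF bij_betw_the_inv_into[OF bij]]
    by (auto simp: G_def f_the_inv_into_f_bij_betw)
  have F: "F X \<in> Obj D" if "X \<in> Obj C" for X
    using that bij by (rule bij_betw_apply[rotated])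
  have homD: "Hom D X Y = Hom C (G X) (G Y)" if "X \<in> Obj D" "Y \<in> Obj D" for X Y
    using hom[OF G G, OF that] that by (simp add: FG)
  have idD: "Id D X = Id C (G X)" if "X \<in> Obj D" for X
    using id[OF G, OF that] that by (simp add: FG)
  have compD: "Comp D X Y Z = Comp C (G X) (G Y) (G Z)"
    if "X \<in> Obj D" "Y \<in> Obj D" "Z \<in> Obj D" for X Y Z
    using comp[OF G G G, OF that] that by (simp add: FG)
  interpret D: category D
    by standard (simp_all add: homD idD compD G C.Id_in_Hom C.Comp_in_Hom C.Comp_Id_left
        C.Comp_Id_right C.Comp_assoc)
  have "cat_functor C D F (\<lambda>X Y h. h)"
    by standard (simp_all add: F hom id comp)
  moreover have "cat_functor D C G (\<lambda>X Y h. h)"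
    by standard (simp_all add: G homD idD compD)
  ultimately show ?thesis
    unfolding category_isomorphism_def using GF FG by blast
qed

theorem theorem5p3:
  fixes K :: "('k, 'r) ring_scheme" and l :: 'k
  assumes "cring K" and "l \<in> carrier K"
  shows "category_isomorphism
    (DRB K l :: (('k, 'a) drb, 'a \<Rightarrow> 'a) category) (RBA_coalg K l)
    cocomparison_obj cocomparison_mor"
proof -
  have "category_isomorphism (DRB K l :: (('k, 'a) drb, 'a \<Rightarrow> 'a) category) (RBA_coalg K l)
      cocomparison_obj (\<lambda>X Y h. h)"
  proof (rule category_isomorphism_transport)
    show "bij_betw cocomparison_obj (Obj (DRB K l :: (('k, 'a) drb, 'a \<Rightarrow> 'a) category))
        (Obj (RBA_coalg K l))"
      using cocomparison_obj_bij[OF assms(2)] by (simp add: DRB_def RBA_coalg_def)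
  next
    fix X Y :: "('k, 'a) drb"
    assume "X \<in> Obj (DRB K l)" "Y \<in> Obj (DRB K l)"
    then show "Hom (RBA_coalg K l) (cocomparison_obj X) (cocomparison_obj Y) = Hom (DRB K l) X Y"
      using coalg_mor_cocomparison[OF assms(2), of X Y] by (simp add: DRB_def RBA_coalg_def)
  qed (auto simp: category_DRB DRB_def RBA_coalg_def cocomparison_obj_def V_obj_def
      category_DRB[unfolded DRB_def])
  moreover have "(cocomparison_mor :: ('k, 'a) drb \<Rightarrow> _) = (\<lambda>X Y h. h)"
    by (simp add: cocomparison_mor_def fun_eq_iff)
  ultimately show ?thesis by simp
qed

end
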